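(* For negative reputation system settings, there is no social reputation rule that satisfies all three of the postulates Generality (G), B-Transitivity (BT) and B-Weak-Monotonicity (BM). By relaxing any one of these postulates an appropriate social ranking is obtained, that is: there is a social reputation rule satisfying G and BT; there is a social reputation rule satisfying G and BM; and there is a social reputation rule (defined on some nonempty class of settings) satisfying BT and BM.
   Context: A negative reputation system setting is a finite directed graph $G=(V,E)$ without self-loops, where $V$ is the set of agents and $E\subseteq V^2$ is the set of negative feedbacks ($(u,v)\in E$ means that $u$ gives negative feedback on $v$). For $v\in V$ let $R(v)=\{u\in V:(u,v)\in E\}$. A social ranking of $G$ is a function $S(G):V\to\{1,\dots,|V|\}$ (not necessarily injective). Write $v_i\ge v_j$ if $S(G)(v_i)\le S(G)(v_j)$ (so a smaller number means ranked higher), and $v_i>v_j$ if $v_i\ge v_j$ but not $v_j\ge v_i$. As usual $v\le w$ means $w\ge v$, and $v<w$ means $w>v$. A social reputation rule $S$ assigns to each negative reputation system setting $G$ in some nonempty class of settings (its domain) a social ranking $S(G)$ of the nodes of $G$. Given $G$ and $S(G)$, $R(v_i)$ is more reliable than $R(v_j)$ if there is an injective map $f:R(v_j)\to R(v_i)$ such that $v\le f(v)$ for every $v\in R(v_j)$, and either $f$ is not onto or there is at least one $v\in R(v_j)$ with $v<f(v)$. Postulates for a rule $S$: - Generality (G): $S$ is defined on every negative reputation system setting. - B-Transitivity (BT): for every $G=(V,E)$ in the domain of $S$, with respect to $S(G)$: for all $v_i,v_j\in V$, if $R(v_i)$ is more reliable than $R(v_j)$ then $v_i<v_j$. - B-Weak-Monotonicity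 (BM): for every $G=(V,E)$ in the domain of $S$, with respect to $S(G)$: for all $v_i,v_j\in V$, if $R(v_i)$ is not more reliable than $R(v_j)$ but $v_i<v_j$, then there exist $v_1\in R(v_i)$ and $v_2\in R(v_j)$ such that $v_1>v_2$. *)

theory Defs
  imports "Graph_Theory.Pair_Digraph"
begin

text \<open>
  A negative reputation system setting is a finite directed graph without loops and without
  parallel arcs, i.e. a \<^const>\<open>pair_digraph\<close>. An arc \<open>(u, v)\<close> means that \<open>u\<close> gives negative
  feedback on \<open>v\<close>. Neither symmetry nor nonemptiness of the vertex set is required.
\<close>

definition feedback_givers :: "'a pair_pre_digraph \<Rightarrow> 'a \<Rightarrow> 'a set" where
  "feedback_givers G v = {u \<in> pverts G. (u, v) \<in> parcs G}"

text \<open>Rankings need not be injective; the smaller the number, the higher the rank.\<close>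

definition social_ranking :: "'a pair_pre_digraph \<Rightarrow> ('a \<Rightarrow> nat) \<Rightarrow> bool" where
  "social_ranking G r \<longleftrightarrow> r \<in> pverts G \<rightarrow>\<^sub>E {1..card (pverts G)}"

definition ranked_ge :: "('a \<Rightarrow> nat) \<Rightarrow> 'a \<Rightarrow> 'a \<Rightarrow> bool" where
  "ranked_ge r v w \<longleftrightarrow> r v \<le> r w"

definition ranked_gt :: "('a \<Rightarrow> nat) \<Rightarrow> 'a \<Rightarrow> 'a \<Rightarrow> bool" where
  "ranked_gt r v w \<longleftrightarrow> ranked_ge r v w \<and> \<not> ranked_ge r w v"

abbreviation ranked_le :: "('a \<Rightarrow> nat) \<Rightarrow> 'a \<Rightarrow> 'a \<Rightarrow> bool" where
  "ranked_le r v w \<equiv> ranked_ge r w v"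

abbreviation ranked_lt :: "('a \<Rightarrow> nat) \<Rightarrow> 'a \<Rightarrow> 'a \<Rightarrow> bool" where
  "ranked_lt r v w \<equiv> ranked_gt r w v"

text \<open>\<open>more_reliable r A B\<close>: the set \<open>A\<close> is more reliable than the set \<open>B\<close> under the ranking \<open>r\<close>.\<close>

definition more_reliable :: "('a \<Rightarrow> nat) \<Rightarrow> 'a set \<Rightarrow> 'a set \<Rightarrow> bool" where
  "more_reliable r A B \<longleftrightarrow>
     (\<exists>f. f \<in> B \<rightarrow> A \<and> inj_on f B \<and> (\<forall>v\<in>B. ranked_le r v (f v)) \<and>
          (f ` B \<noteq> A \<or> (\<exists>v\<in>B. ranked_lt r v (f v))))"

text \<open>A rule is a partial function on graphs; its domain is the class of settings it ranks.\<close>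

type_synonym 'a rule = "'a pair_pre_digraph \<rightharpoonup> ('a \<Rightarrow> nat)"

definition social_reputation_rule :: "'a rule \<Rightarrow> bool" where
  "social_reputation_rule S \<longleftrightarrow>
     dom S \<noteq> {} \<and> (\<forall>G\<in>dom S. pair_digraph G \<and> social_ranking G (the (S G)))"

definition generality :: "'a rule \<Rightarrow> bool" where
  "generality S \<longleftrightarrow> (\<forall>G. pair_digraph G \<longrightarrow> G \<in> dom S)"

definition b_transitivity :: "'a rule \<Rightarrow> bool" where
  "b_transitivity S \<longleftrightarrow>
     (\<forall>G\<in>dom S. \<forall>vi\<in>pverts G. \<forall>vj\<in>pverts G.
        more_reliable (the (S G)) (feedback_givers G vi) (feedback_givers G vj) \<longrightarrow>
        ranked_lt (the (S G)) vi vj)"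

definition b_weak_monotonicity :: "'a rule \<Rightarrow> bool" where
  "b_weak_monotonicity S \<longleftrightarrow>
     (\<forall>G\<in>dom S. \<forall>vi\<in>pverts G. \<forall>vj\<in>pverts G.
        \<not> more_reliable (the (S G)) (feedback_givers G vi) (feedback_givers G vj) \<and>
        ranked_lt (the (S G)) vi vj \<longrightarrow>
        (\<exists>v1\<in>feedback_givers G vi. \<exists>v2\<in>feedback_givers G vj. ranked_gt (the (S G)) v1 v2))"

end

theory Submission
  imports Defs
begin

text \<open>
  Impossibility: on the graph made of the cycle \<open>p \<rightarrow> a \<rightarrow> b \<rightarrow> p\<close> and of
  \<open>q \<rightarrow> c \<rightarrow> {d, e} \<rightarrow> q\<close>, BT and BM force the comparison of two nodes with one feedback
  giver each to be the reverse of the comparison of these givers. Two such reversals transport the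
  comparison of \<open>p\<close> and \<open>q\<close> to that of \<open>b\<close> with \<open>d\<close> and \<open>e\<close>. If \<open>q < p\<close>, then \<open>d\<close> and \<open>e\<close> are
  strictly below \<open>b\<close>, and BM gives \<open>q \<ge> p\<close>; otherwise they are at least as high as \<open>b\<close>, and BT
  gives \<open>q < p\<close>.

  G and BT: among all rankings for which weak domination of the sets of feedback givers implies the
  weak comparison of the nodes (the constant ranking is one), take a ranking with as many
  levels as possible. Splitting its levels by the total height of the feedback givers keeps this
  property, so by maximality nothing is split, and strict domination implies strict comparison.

  G and BM: rank all nodes equally. BT and BM: do the same on graphs without arcs.
\<close>

section \<open>Reliability of sets under a change of ranking\<close>

lemma ranked_gt_iff: "ranked_gt r v w \<longleftrightarrow> r v < r w"
  by (auto simp: ranked_gt_def ranked_ge_def)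

text \<open>Reliability without its strictness clause. Unlike \<open>more_reliable\<close>, it
  survives the passage to a coarser ranking, where strict comparisons may collapse.\<close>

definition dominates :: "('a \<Rightarrow> nat) \<Rightarrow> 'a set \<Rightarrow> 'a set \<Rightarrow> bool" where
  "dominates r A B \<longleftrightarrow> (\<exists>f. f \<in> B \<rightarrow> A \<and> inj_on f B \<and> (\<forall>v\<in>B. r (f v) \<le> r v))"

lemma more_reliable_imp_dominates: "more_reliable r A B \<Longrightarrow> dominates r A B"
  unfolding more_reliable_def dominates_def ranked_ge_def by blast

lemma dominates_mono:
  assumes "dominates r A B" "A \<subseteq> V" "B \<subseteq> V"
    and "\<And>u v. u \<in> V \<Longrightarrow> v \<in> V \<Longrightarrow> r u \<le> r v \<Longrightarrow> s u \<le> s v"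
  shows "dominates s A B"
proof -
  obtain f where f: "f \<in> B \<rightarrow> A" "inj_on f B" "\<forall>v\<in>B. r (f v) \<le> r v"
    using assms(1) unfolding dominates_def by blast
  have "\<forall>v\<in>B. s (f v) \<le> s v"
    using f(1,3) assms(2-4) by (blast dest: funcset_mem)
  with f(1,2) show ?thesis unfolding dominates_def by blast
qed

text \<open>Strict comparisons have to be carried over as well, hence the equivalence in the last
  hypothesis.\<close>

lemma more_reliable_mono:
  assumes "more_reliable r A B" "A \<subseteq> V" "B \<subseteq> V"
    and "\<And>u v. u \<in> V \<Longrightarrow> v \<in> V \<Longrightarrow> r u \<le> r v \<longleftrightarrow> s u \<le> s v"
  shows "more_reliable s A B"
proof -
  obtain f where f: "f \<in> B \<rightarrow> A" "inj_on f B" "\<forall>v\<in>B. r (f v) \<le> r v"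
      "f ` B \<noteq> A \<or> (\<exists>v\<in>B. r (f v) < r v)"
    using assms(1) unfolding more_reliable_def ranked_gt_iff unfolding ranked_ge_def by blast
  have V: "v \<in> V \<and> f v \<in> V" if "v \<in> B" for v
    using that f(1) assms(2,3) by (blast dest: funcset_mem)
  have "\<forall>v\<in>B. s (f v) \<le> s v"
    using f(3) assms(4) V by blast
  moreover have "f ` B \<noteq> A \<or> (\<exists>v\<in>B. s (f v) < s v)"
    using f(4) assms(4) V by (meson linorder_not_less)
  ultimately show ?thesis
    using f(1,2) unfolding more_reliable_def ranked_gt_iff unfolding ranked_ge_def by blast
qed

lemma not_more_reliable_empty: "\<not> more_reliable r {} A"
  unfolding more_reliable_def by auto

lemma more_reliable_singleton: "r a < r b \<Longrightarrow> more_reliable r {a} {b}"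
  unfolding more_reliable_def ranked_gt_iff unfolding ranked_ge_def
  by (intro exI[of _ "\<lambda>_. a"]) auto

lemma more_reliable_pair_singleton:
  "r a \<le> r c \<Longrightarrow> a \<noteq> b \<Longrightarrow> more_reliable r {a, b} {c}"
  unfolding more_reliable_def ranked_gt_iff unfolding ranked_ge_def
  by (intro exI[of _ "\<lambda>_. a"]) auto

section \<open>Heights and their sums\<close>

text \<open>Turns ranks into numbers that are positive on \<open>V\<close> and grow towards the top
  of the ranking, so that sets of nodes can be compared by sums.\<close>

definition height :: "'a set \<Rightarrow> ('a \<Rightarrow> nat) \<Rightarrow> 'a \<Rightarrow> nat" where
  "height V r u = card {w \<in> V. r u \<le> r w}"

lemma height_pos: "finite V \<Longrightarrow> u \<in> V \<Longrightarrow> 0 < height V r u"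
  by (auto simp: height_def card_gt_0_iff)

lemma height_mono: "finite V \<Longrightarrow> r u \<le> r v \<Longrightarrow> height V r v \<le> height V r u"
  unfolding height_def by (rule card_mono) auto

lemma height_strict_mono:
  assumes "finite V" "u \<in> V" "r u < r v"
  shows "height V r v < height V r u"
  unfolding height_def
proof (rule psubset_card_mono)
  have "u \<in> {w \<in> V. r u \<le> r w} - {w \<in> V. r v \<le> r w}"
    using assms by auto
  moreover have "{w \<in> V. r v \<le> r w} \<subseteq> {w \<in> V. r u \<le> r w}"
    using assms(3) by auto
  ultimately show "{w \<in> V. r v \<le> r w} \<subset> {w \<in> V. r u \<le> r w}"
    by blast
qed (use assms in auto)

lemma dominates_sum_height:
  assumes "finite V" "A \<subseteq> V" "dominates r A B"
  shows "sum (height V r) B \<le> sum (height V r) A"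
proof -
  obtain f where f: "f \<in> B \<rightarrow> A" "inj_on f B" "\<forall>v\<in>B. r (f v) \<le> r v"
    using assms(3) unfolding dominates_def by blast
  have "sum (height V r) B \<le> (\<Sum>v\<in>B. height V r (f v))"
    using f(3) assms(1) by (intro sum_mono height_mono) auto
  also have "\<dots> = sum (height V r) (f ` B)"
    using f(2) by (simp add: sum.reindex)
  also have "\<dots> \<le> sum (height V r) A"
    using f(1) assms(1,2) by (intro sum_mono2) (auto intro: finite_subset)
  finally show ?thesis .
qed

text \<open>Either source of strictness shows in the sum: a node of \<open>A\<close> missed by
  \<open>f\<close> adds a positive height, and a strict step of \<open>f\<close> enlarges one
  summand.\<close>

lemma more_reliable_sum_height:
  assumes "finite V" "A \<subseteq> V" "B \<subseteq> V" "more_reliable r A B"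
  shows "sum (height V r) B < sum (height V r) A"
proof -
  obtain f where f: "f \<in> B \<rightarrow> A" "inj_on f B" "\<forall>v\<in>B. r (f v) \<le> r v"
      and strict: "f ` B \<noteq> A \<or> (\<exists>v\<in>B. r (f v) < r v)"
    using assms(4) unfolding more_reliable_def ranked_gt_iff unfolding ranked_ge_def by blast
  have fin: "finite A" "finite B"
    using assms(1-3) by (auto intro: finite_subset)
  have sub: "f ` B \<subseteq> A" using f(1) by blast
  have le1: "sum (height V r) B \<le> (\<Sum>v\<in>B. height V r (f v))"
    using f(3) assms(1) by (intro sum_mono height_mono) auto
  have eq: "(\<Sum>v\<in>B. height V r (f v)) = sum (height V r) (f ` B)"
    using f(2) by (simp add: sum.reindex)
  have le2: "sum (height V r) (f ` B) \<le> sum (height V r) A"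
    using sub fin by (intro sum_mono2) auto
  from strict show ?thesis
  proof
    assume "f ` B \<noteq> A"
    then obtain u where u: "u \<in> A - f ` B" using sub by blast
    have "sum (height V r) (f ` B) < sum (height V r) A"
      using u sub fin assms(1,2) by (intro sum_strict_mono2[of _ _ u]) (auto intro: height_pos)
    with le1 eq show ?thesis by linarith
  next
    assume "\<exists>v\<in>B. r (f v) < r v"
    then obtain v where v: "v \<in> B" "r (f v) < r v" by blast
    then have "height V r v < height V r (f v)"
      using assms(1,2) sub by (intro height_strict_mono) auto
    then have "sum (height V r) B < (\<Sum>v\<in>B. height V r (f v))"
      using f(3) assms(1) fin v(1) by (intro sum_strict_mono_ex1) (auto intro: height_mono)
    with eq le2 show ?thesis by linarith
  qed
qed

section \<open>Rankings with B-Transitivity\<close>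

text \<open>Reliability is measured by the very ranking sought, so there is no order given in
  advance to sort along; an extremal choice resolves this circularity.\<close>

lemma ex_strict_ranking:
  fixes R :: "'a \<Rightarrow> 'a set"
  assumes fin: "finite V" and R: "\<And>v. R v \<subseteq> V"
  obtains r :: "'a \<Rightarrow> nat"
    where "\<forall>u\<in>V. \<forall>v\<in>V. more_reliable r (R u) (R v) \<longrightarrow> r v < r u"
proof -
  define W :: "('a \<Rightarrow> nat) \<Rightarrow> bool"
    where "W r \<longleftrightarrow> (\<forall>u\<in>V. \<forall>v\<in>V. dominates r (R u) (R v) \<longrightarrow> r v \<le> r u)" for r
  have "W (\<lambda>_. 0)" by (simp add: W_def)
  \<comment> \<open>The number of levels is bounded by the number of nodes, so a maximum
    exists.\<close>
  moreover have "\<forall>r. W r \<longrightarrow> card (r ` V) < Suc (card V)"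
    by (simp add: less_Suc_eq_le card_image_le[OF fin])
  ultimately obtain r where r: "W r" and max: "\<And>s. W s \<Longrightarrow> card (s ` V) \<le> card (r ` V)"
    using ex_has_greatest_nat[of W "\<lambda>_. 0" "\<lambda>r. card (r ` V)"] by blast
  define weight where "weight v = sum (height V r) (R v)" for v
  \<comment> \<open>\<open>K\<close> exceeds every weight on \<open>V\<close>, so \<open>key\<close>
    orders lexicographically by \<open>r\<close>, then by \<open>weight\<close>, and division by
    \<open>K\<close> recovers \<open>r\<close>.\<close>
  define K where "K = Suc (sum weight V)"
  define key where "key v = weight v + r v * K" for v
  have weight_less: "weight v < K" if "v \<in> V" for v
    unfolding K_def using member_le_sum[of v V weight] that fin by (simp add: less_Suc_eq_le)
  have key_div: "key v div K = r v" if "v \<in> V" for v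
    using weight_less[OF that] by (simp add: key_def)
  have "W key"
    unfolding W_def
  proof (intro ballI impI)
    fix u v assume uv: "u \<in> V" "v \<in> V" and dom: "dominates key (R u) (R v)"
    \<comment> \<open>\<open>key\<close> refines \<open>r\<close>, so domination under
      \<open>key\<close> is also domination under \<open>r\<close>, to which \<open>W r\<close> and
      the heights apply.\<close>
    have dom_r: "dominates r (R u) (R v)"
      using dom R R by (rule dominates_mono) (metis key_div div_le_mono)
    then have "r v \<le> r u" using r uv by (auto simp: W_def)
    moreover have "weight v \<le> weight u"
      unfolding weight_def using dominates_sum_height[OF fin R dom_r] .
    ultimately show "key v \<le> key u"
      unfolding key_def by (intro add_mono mult_right_mono) auto
  qed
  \<comment> \<open>The levels of \<open>r\<close> are the quotients of those of \<open>key\<close>;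
    by maximality there are equally many, so no level of \<open>r\<close> has been split.\<close>
  have image: "r ` V = (\<lambda>k. k div K) ` key ` V"
    using key_div by (auto simp: image_image)
  have "card ((\<lambda>k. k div K) ` key ` V) = card (key ` V)"
    using max[OF \<open>W key\<close>] card_image_le[of "key ` V" "\<lambda>k. k div K"] fin image by auto
  then have inj: "inj_on (\<lambda>k. k div K) (key ` V)"
    using fin by (intro eq_card_imp_inj_on) auto
  show thesis
  proof (rule that, intro ballI impI)
    fix u v assume uv: "u \<in> V" "v \<in> V" and more: "more_reliable r (R u) (R v)"
    have "r v \<le> r u"
      using more_reliable_imp_dominates[OF more] r uv by (auto simp: W_def)
    moreover have "r v \<noteq> r u"
    proof
      \<comment> \<open>Equal levels have equal keys, hence equal weights, against the strict growth
        of height sums.\<close>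
      assume eq: "r v = r u"
      then have "key v = key u"
        using inj_onD[OF inj, of "key v" "key u"] uv key_div by simp
      with eq have "weight v = weight u" by (simp add: key_def)
      with more_reliable_sum_height[OF fin R R more] show False
        by (simp add: weight_def)
    qed
    ultimately show "r v < r u" by simp
  qed
qed

lemma ex_normalized_ranking:
  fixes r :: "'a \<Rightarrow> nat"
  assumes "finite V"
  obtains s where "s \<in> V \<rightarrow>\<^sub>E {1..card V}"
    and "\<forall>u\<in>V. \<forall>v\<in>V. s u \<le> s v \<longleftrightarrow> r u \<le> r v"
proof
  \<comment> \<open>Each node counts itself, so the values start at 1; the restriction to
    \<open>V\<close> provides extensionality.\<close>
  define s where "s = (\<lambda>v\<in>V. card {u \<in> V. r u \<le> r v})"
  have less: "s u < s v" if "u \<in> V" "v \<in> V" "r u < r v" for u v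
  proof -
    have "v \<in> {w \<in> V. r w \<le> r v} - {w \<in> V. r w \<le> r u}" using that by auto
    moreover have "{w \<in> V. r w \<le> r u} \<subseteq> {w \<in> V. r w \<le> r v}" using that by auto
    ultimately have "{w \<in> V. r w \<le> r u} \<subset> {w \<in> V. r w \<le> r v}" by blast
    then show ?thesis
      using that assms by (simp add: s_def psubset_card_mono)
  qed
  have "1 \<le> card {u \<in> V. r u \<le> r v}" if "v \<in> V" for v
    using assms that by (auto simp: Suc_le_eq card_gt_0_iff)
  then show "s \<in> V \<rightarrow>\<^sub>E {1..card V}"
    using assms by (auto simp: s_def intro: card_mono)
  show "\<forall>u\<in>V. \<forall>v\<in>V. s u \<le> s v \<longleftrightarrow> r u \<le> r v"
  proof (intro ballI iffI)
    fix u v assume uv: "u \<in> V" "v \<in> V"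
    show "r u \<le> r v" if "s u \<le> s v"
      using less[of v u] that uv by (meson linorder_not_less)
    show "s u \<le> s v" if "r u \<le> r v"
      using that uv assms unfolding s_def by (auto intro!: card_mono)
  qed
qed

lemma feedback_givers_subset: "feedback_givers G v \<subseteq> pverts G"
  by (auto simp: feedback_givers_def)

lemma finite_pverts: "pair_digraph G \<Longrightarrow> finite (pverts G)"
  unfolding pair_digraph_def by (simp add: pair_fin_digraph.pair_finite_verts)

lemma ex_transitive_ranking:
  assumes "pair_digraph G"
  shows "\<exists>s. social_ranking G s \<and> (\<forall>u\<in>pverts G. \<forall>v\<in>pverts G.
    more_reliable s (feedback_givers G u) (feedback_givers G v) \<longrightarrow> ranked_lt s u v)"
proof -
  let ?V = "pverts G" and ?R = "feedback_givers G"
  have fin: "finite ?V" using assms by (rule finite_pverts)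
  obtain r where r: "\<forall>u\<in>?V. \<forall>v\<in>?V. more_reliable r (?R u) (?R v) \<longrightarrow> r v < r u"
    by (rule ex_strict_ranking[where R = ?R, OF fin feedback_givers_subset])
  obtain s where s: "s \<in> ?V \<rightarrow>\<^sub>E {1..card ?V}"
    and s_iff: "\<forall>u\<in>?V. \<forall>v\<in>?V. s u \<le> s v \<longleftrightarrow> r u \<le> r v"
    by (rule ex_normalized_ranking[OF fin])
  have "s v < s u" if "u \<in> ?V" "v \<in> ?V" "more_reliable s (?R u) (?R v)" for u v
  proof -
    \<comment> \<open>Normalization keeps the order of the nodes, and reliability depends on nothing
      else.\<close>
    have "more_reliable r (?R u) (?R v)"
      using that(3) feedback_givers_subset feedback_givers_subset
      by (rule more_reliable_mono) (use s_iff in blast)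
    with r that show ?thesis using s_iff by (meson linorder_not_less)
  qed
  with s show ?thesis by (auto simp: social_ranking_def ranked_gt_iff)
qed

section \<open>Rules for each pair of postulates\<close>

lemma pair_digraph_empty: "pair_digraph \<lparr>pverts = {}, parcs = {}\<rparr>"
  by unfold_locales auto

lemma ex_rule_generality_transitivity:
  "\<exists>S :: 'a rule. social_reputation_rule S \<and> generality S \<and> b_transitivity S"
proof -
  obtain s :: "'a pair_pre_digraph \<Rightarrow> 'a \<Rightarrow> nat" where
    s: "\<And>G. pair_digraph G \<Longrightarrow> social_ranking G (s G) \<and> (\<forall>u\<in>pverts G. \<forall>v\<in>pverts G.
      more_reliable (s G) (feedback_givers G u) (feedback_givers G v) \<longrightarrow> ranked_lt (s G) u v)"
    using ex_transitive_ranking by metis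
  define S where "S G = (if pair_digraph G then Some (s G) else None)" for G
  have dom: "dom S = {G. pair_digraph G}" by (auto simp: S_def dom_def)
  have "social_reputation_rule S"
    unfolding social_reputation_rule_def dom using pair_digraph_empty s by (auto simp: S_def)
  moreover have "b_transitivity S"
    unfolding b_transitivity_def dom using s by (simp add: S_def)
  moreover have "generality S" by (simp add: generality_def dom)
  ultimately show ?thesis by blast
qed

definition constant_ranking :: "'a pair_pre_digraph \<Rightarrow> 'a \<Rightarrow> nat" where
  "constant_ranking G = (\<lambda>v\<in>pverts G. 1)"

text \<open>BM is vacuous, since no node is strictly above another. The class \<open>C\<close> is a
  parameter so that it can be all settings or only those without arcs.\<close>

lemma constant_rule:
  fixes C :: "'a pair_pre_digraph set"
  assumes "C \<noteq> {}" "\<And>G. G \<in> C \<Longrightarrow> pair_digraph G"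
  defines "S \<equiv> \<lambda>G. if G \<in> C then Some (constant_ranking G) else None"
  shows "dom S = C" "social_reputation_rule S" "b_weak_monotonicity S"
proof -
  show dom: "dom S = C" by (auto simp: S_def dom_def)
  have "social_ranking G (constant_ranking G)" if "G \<in> C" for G
    using finite_pverts[OF assms(2)[OF that]]
    by (auto simp: social_ranking_def constant_ranking_def Suc_le_eq card_gt_0_iff)
  then show "social_reputation_rule S"
    unfolding social_reputation_rule_def dom using assms(1,2) by (auto simp: S_def)
  show "b_weak_monotonicity S"
    unfolding b_weak_monotonicity_def dom
    by (simp add: S_def ranked_gt_iff constant_ranking_def)
qed

lemma ex_rule_generality_weak_monotonicity:
  "\<exists>S :: 'a rule. social_reputation_rule S \<and> generality S \<and> b_weak_monotonicity S"
proof -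
  have "{G :: 'a pair_pre_digraph. pair_digraph G} \<noteq> {}"
    using pair_digraph_empty by blast
  from constant_rule[OF this] obtain S :: "'a rule"
    where "dom S = {G. pair_digraph G}" "social_reputation_rule S" "b_weak_monotonicity S"
    by blast
  then show ?thesis by (auto simp: generality_def)
qed

lemma ex_rule_transitivity_weak_monotonicity:
  "\<exists>S :: 'a rule. social_reputation_rule S \<and> b_transitivity S \<and> b_weak_monotonicity S"
proof -
  let ?C = "{G :: 'a pair_pre_digraph. pair_digraph G \<and> parcs G = {}}"
  have "\<lparr>pverts = {}, parcs = {}\<rparr> \<in> ?C"
    using pair_digraph_empty by simp
  then have "?C \<noteq> {}" by blast
  from constant_rule[OF this] obtain S :: "'a rule"
    where S: "dom S = ?C" "social_reputation_rule S" "b_weak_monotonicity S"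
    by blast
  \<comment> \<open>Without arcs all sets of feedback givers are empty, and the empty map is onto
    the empty set and has no strict step.\<close>
  have "b_transitivity S"
    unfolding b_transitivity_def S(1)
    by (simp add: feedback_givers_def not_more_reliable_empty)
  with S show ?thesis by blast
qed

section \<open>Impossibility of all three postulates\<close>

lemma no_rule_all_postulates:
  fixes S :: "'a rule"
  assumes inf: "infinite (UNIV :: 'a set)"
    and gen: "generality S" and bt: "b_transitivity S" and bm: "b_weak_monotonicity S"
  shows False
proof -
  obtain f :: "nat \<Rightarrow> 'a" where f: "inj f"
    using infinite_countable_subset[OF inf] by blast
  define p a b q c d e
    where vs: "p = f 0" "a = f 1" "b = f 2" "q = f 3" "c = f 4" "d = f 5" "e = f 6"
  have dist: "distinct [p, a, b, q, c, d, e]"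
    unfolding vs using f by (simp add: inj_eq)
  \<comment> \<open>The second half copies the cycle with \<open>b\<close> doubled into
    \<open>d\<close> and \<open>e\<close>, so that only \<open>q\<close> has two feedback
    givers.\<close>
  define G where "G = \<lparr>pverts = {p, a, b, q, c, d, e},
    parcs = {(p, a), (a, b), (b, p), (q, c), (c, d), (c, e), (d, q), (e, q)}\<rparr>"
  have "pair_digraph G"
    by unfold_locales (use dist in \<open>auto simp: G_def\<close>)
  then have G: "G \<in> dom S" using gen by (simp add: generality_def)
  let ?R = "feedback_givers G"
  have V: "p \<in> pverts G" "a \<in> pverts G" "b \<in> pverts G" "q \<in> pverts G"
    "c \<in> pverts G" "d \<in> pverts G" "e \<in> pverts G"
    by (simp_all add: G_def)
  have R: "?R a = {p}" "?R b = {a}" "?R p = {b}" "?R c = {q}" "?R d = {c}" "?R e = {c}"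
    "?R q = {d, e}"
    using dist by (auto simp: feedback_givers_def G_def)
  define r where "r = the (S G)"
  have BT: "r v < r u" if "u \<in> pverts G" "v \<in> pverts G" "more_reliable r (?R u) (?R v)" for u v
    using bt G that unfolding b_transitivity_def ranked_gt_iff r_def by blast
  have BM: "\<exists>x\<in>?R u. \<exists>y\<in>?R v. r x < r y"
    if "u \<in> pverts G" "v \<in> pverts G" "\<not> more_reliable r (?R u) (?R v)" "r v < r u" for u v
    using bm G that unfolding b_weak_monotonicity_def ranked_gt_iff r_def by blast
  have reversal: "r u < r v \<longleftrightarrow> r y < r x"
    if "u \<in> pverts G" "v \<in> pverts G" "?R u = {x}" "?R v = {y}" for u v x y
  proof
    show "r u < r v" if "r y < r x"
      using BT[of v u] \<open>u \<in> _\<close> \<open>v \<in> _\<close> \<open>?R u = _\<close> \<open>?R v = _\<close> that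
      by (simp add: more_reliable_singleton)
    show "r y < r x" if "r u < r v"
    proof (rule ccontr)
      \<comment> \<open>Equal ranks of \<open>x\<close> and \<open>y\<close> make the only map onto
        and without strict step, so \<open>{y}\<close> is not more reliable than \<open>{x}\<close>;
        BM then returns the comparison just denied.\<close>
      assume *: "\<not> r y < r x"
      then have "\<not> more_reliable r (?R v) (?R u)"
        using \<open>?R u = _\<close> \<open>?R v = _\<close>
        by (auto simp: more_reliable_def ranked_gt_iff ranked_ge_def)
      from BM[OF _ _ this \<open>r u < r v\<close>] * show False
        using \<open>u \<in> _\<close> \<open>v \<in> _\<close> \<open>?R u = _\<close> \<open>?R v = _\<close> by auto
    qed
  qed
  \<comment> \<open>The comparison passes from \<open>p\<close>, \<open>q\<close> to
    \<open>a\<close>, \<open>c\<close> and then to \<open>b\<close>, \<open>d\<close> or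
    \<open>b\<close>, \<open>e\<close>; the two reversals cancel.\<close>
  have iff: "r b < r d \<longleftrightarrow> r p < r q" "r b < r e \<longleftrightarrow> r p < r q"
    using reversal[of b d a c] reversal[of b e a c] reversal[of c a q p] R V by simp_all
  show False
  proof (cases "r p < r q")
    case True
    then have less: "r b < r d" "r b < r e" using iff by auto
    \<comment> \<open>The image of \<open>b\<close> would have to be \<open>d\<close> or
      \<open>e\<close>, both strictly below \<open>b\<close>; yet BM asks for one of them strictly
      above \<open>b\<close>.\<close>
    then have "\<not> more_reliable r (?R q) (?R p)"
      using R by (auto simp: more_reliable_def ranked_ge_def)
    from BM[OF _ _ this True] less show False using R V by auto
  next
    case False
    \<comment> \<open>Sending \<open>b\<close> to \<open>d\<close> misses \<open>e\<close>, which
      makes the comparison strict even if all ranks agree.\<close>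
    then have "more_reliable r (?R q) (?R p)"
      using R iff dist by (simp add: more_reliable_pair_singleton)
    from BT[OF _ _ this] False show False using V by auto
  qed
qed

theorem theorem3:
  assumes "infinite (UNIV :: 'a set)"
  shows "\<not> (\<exists>S :: 'a rule. social_reputation_rule S \<and>
               generality S \<and> b_transitivity S \<and> b_weak_monotonicity S)
       \<and> (\<exists>S :: 'a rule. social_reputation_rule S \<and> generality S \<and> b_transitivity S)
       \<and> (\<exists>S :: 'a rule. social_reputation_rule S \<and> generality S \<and> b_weak_monotonicity S)
       \<and> (\<exists>S :: 'a rule. social_reputation_rule S \<and> b_transitivity S \<and> b_weak_monotonicity S)"
  using no_rule_all_postulates[OF assms] ex_rule_generality_transitivity
    ex_rule_generality_weak_monotonicity ex_rule_transitivity_weak_monotonicity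
  by blast

end
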